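(* Let $p_1<p_2$ be finite real numbers, let $f$ be a symbol with $f''>0$ as in the context, and let $u_0\in\mathcal S(\mathbb R)$ satisfy $\mathrm{supp}\,\mathcal F u_0\subseteq[p_1,p_2]$ and $\|u_0\|_{L^2(\mathbb R)}=1$. Let $t^*=\operatorname*{arg\,min}_{\tau\in\mathbb R}\mathcal V\big(u_f(\tau,\cdot)\big)$ and $x^*=\mathcal M_1\big(u_f(t^*,\cdot)\big)$. Then for all $t\in\mathbb R\setminus\{t^*\}$, we have $$\mathcal M_1\big(u_f(t,\cdot)\big)=\mathcal M_1\big(H_f(t,\cdot,u_0,t^*,x^* )\big)$$ and $$\mathcal V\big(u_f(t,\cdot)\big)-\mathcal V\big(H_f(t,\cdot,u_0,t^*,x^* )\big)=\min_{\tau\in\mathbb R}\mathcal V\big(u_f(\tau,\cdot)\big).$$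
   Context: Fourier transform: $\mathcal F u(p)=\int_{\mathbb R}u(x)e^{-ixp}\,dx$. The symbol $f:\mathbb R\to\mathbb R$ is $\mathcal C^\infty$, all its derivatives grow at most polynomially at infinity, and $f''>0$ on $\mathbb R$. The wave packet is $u_f(t,x)=\frac1{2\pi}\int_{\mathbb R}\mathcal F u_0(p)\,e^{-itf(p)+ixp}\,dp$. For $(t_0,x_0)\in\mathbb R^2$, $t\neq t_0$ and $x\in\mathbb R$, with $p_0(t,x):=(f')^{-1}\big(\frac{x-x_0}{t-t_0}\big)$, $$H_f(t,x,u_0,t_0,x_0):=\frac1{\sqrt{2\pi}}\,e^{-\mathrm{sgn}(t-t_0)i\frac\pi4}\,e^{-itf(p_0(t,x))+ixp_0(t,x)}\,\frac{\mathcal F u_0(p_0(t,x))}{\sqrt{f''(p_0(t,x))}}\,|t-t_0|^{-\frac12};$$ this function is supported in $\{(t,x):f'(p_1)\leqslant\frac{x-x_0}{t-t_0}\leqslant f'(p_2)\}$ and is understood to be $0$ where $\frac{x-x_0}{t-t_0}\notin f'(\mathbb R)$. For $u$ with $\|u\|_{L^2(\mathbb R)}=1$: $\mathcal M_1(u)=\int_{\mathbb R}x|u(x)|^2dx$, $\mathcal M_2(u)=\int_{\mathbb R}x^2|u(x)|^2dx$, $\mathcal V(u)=\mathcal M_2(u)-\mathcal M_1(u)^2$. *)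

theory Defs
  imports "HOL-Analysis.Analysis"
begin

definition fourier :: "(real \<Rightarrow> complex) \<Rightarrow> real \<Rightarrow> complex" where
  "fourier u p = (LINT x|lborel. u x * exp (- \<i> * of_real (x * p)))"

text \<open>The derivatives of a complex-valued function of a real variable are vector
  derivatives; \<^const>\<open>deriv\<close> only covers functions from a field to itself.\<close>

definition vderivs :: "nat \<Rightarrow> (real \<Rightarrow> complex) \<Rightarrow> real \<Rightarrow> complex" where
  "vderivs k u = ((\<lambda>g x. vector_derivative g (at x)) ^^ k) u"

definition schwartz :: "(real \<Rightarrow> complex) \<Rightarrow> bool" where
  "schwartz u \<longleftrightarrow>
     (\<forall>k x. vderivs k u differentiable at x) \<and>
     (\<forall>j k. \<exists>C. \<forall>x. cmod (of_real x ^ j * vderivs k u x) \<le> C)"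

definition poly_growth :: "(real \<Rightarrow> real) \<Rightarrow> bool" where
  "poly_growth g \<longleftrightarrow> (\<exists>C. \<exists>N::nat. \<forall>x. \<bar>g x\<bar> \<le> C * (1 + \<bar>x\<bar>) ^ N)"

definition symbol :: "(real \<Rightarrow> real) \<Rightarrow> bool" where
  "symbol f \<longleftrightarrow>
     (\<forall>k x. (deriv ^^ k) f differentiable at x) \<and>
     (\<forall>k. poly_growth ((deriv ^^ k) f)) \<and>
     (\<forall>x. deriv (deriv f) x > 0)"

definition L2_norm :: "(real \<Rightarrow> complex) \<Rightarrow> real" where
  "L2_norm u = sqrt (LINT x|lborel. (cmod (u x))\<^sup>2)"

definition wave_packet :: "(real \<Rightarrow> real) \<Rightarrow> (real \<Rightarrow> complex) \<Rightarrow> real \<Rightarrow> real \<Rightarrow> complex" where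
  "wave_packet f u\<^sub>0 t x =
     1 / (2 * of_real pi) *
     (LINT p|lborel. fourier u\<^sub>0 p * exp (- \<i> * of_real (t * f p) + \<i> * of_real (x * p)))"

text \<open>For a symbol \<open>f\<close> the function \<open>deriv f\<close> is strictly increasing, so on its range
  \<open>inv (deriv f)\<close> is its genuine inverse.\<close>

definition H :: "(real \<Rightarrow> real) \<Rightarrow> (real \<Rightarrow> complex) \<Rightarrow> real \<Rightarrow> real \<Rightarrow> real \<Rightarrow> real \<Rightarrow> complex" where
  "H f u\<^sub>0 t\<^sub>0 x\<^sub>0 t x =
     (if (x - x\<^sub>0) / (t - t\<^sub>0) \<in> range (deriv f) then
        (let p\<^sub>0 = inv (deriv f) ((x - x\<^sub>0) / (t - t\<^sub>0)) in
           of_real (1 / sqrt (2 * pi)) *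
           exp (- of_real (sgn (t - t\<^sub>0)) * \<i> * of_real (pi / 4)) *
           exp (- \<i> * of_real (t * f p\<^sub>0) + \<i> * of_real (x * p\<^sub>0)) *
           (fourier u\<^sub>0 p\<^sub>0 / of_real (sqrt (deriv (deriv f) p\<^sub>0))) *
           of_real (\<bar>t - t\<^sub>0\<bar> powr (- 1 / 2)))
      else 0)"

definition moment1 :: "(real \<Rightarrow> complex) \<Rightarrow> real" where
  "moment1 u = (LINT x|lborel. x * (cmod (u x))\<^sup>2)"

definition moment2 :: "(real \<Rightarrow> complex) \<Rightarrow> real" where
  "moment2 u = (LINT x|lborel. x\<^sup>2 * (cmod (u x))\<^sup>2)"

definition Var :: "(real \<Rightarrow> complex) \<Rightarrow> real" where
  "Var u = moment2 u - (moment1 u)\<^sup>2"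

end

theory Submission
  imports Defs "HOL-Probability.Probability"
begin

text \<open>
  Write \<open>g = fourier u\<^sub>0\<close>; by Plancherel \<open>\<bar>g\<bar>\<^sup>2 / (2\<pi>)\<close> is a
  probability density. On the momentum side the packet at time \<open>t\<close> is the inverse transform
  of \<open>g(p) e\<^sup>-\<^sup>i\<^sup>t\<^sup>f\<^sup>(\<^sup>p\<^sup>)\<close>, and multiplication by
  \<open>x\<close> becomes \<open>\<i> d/dp\<close>. By Plancherel, the first two moments in \<open>x\<close> are integrals over \<open>p\<close> in
  which the phase cancels and leaves only its derivative \<open>-\<i> t f'(p)\<close>
  (\<open>fourier_position_moments\<close>, \<open>packet_moments\<close>). So the first moment is affine in \<open>t\<close>, with slope
  the mean \<open>v\<close> of \<open>f'\<close> under that density, and the variance is a quadratic polynomial in \<open>t\<close> whose leading coefficient \<open>D\<close> is the variance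
  of \<open>f'\<close>. Since \<open>f'\<close> is strictly increasing and \<open>g\<close> is not null, \<open>D > 0\<close>
  (\<open>dispersion_pos\<close>): the variance is a proper parabola \<open>D (t - \<tau>)\<^sup>2 + c\<close> with the single
  minimiser \<open>\<tau>\<close> and minimum \<open>c\<close> (\<open>Var_packet_parabola\<close>).

  The square of the modulus of the asymptotic profile \<open>H\<close> is the image of the same probability
  density under \<open>p \<mapsto> x\<^sub>0 + (t - t\<^sub>0) f'(p)\<close> (\<open>integral_classical_profile\<close>). Its
  mean is \<open>x\<^sub>0 + (t - t\<^sub>0) v\<close> and its variance \<open>(t - t\<^sub>0)\<^sup>2 D\<close>. For \<open>t\<^sub>0 = \<tau>\<close> and
  \<open>x\<^sub>0\<close> the mean of the packet at time \<open>\<tau>\<close>, the mean is that of the packet and the variance falls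
  short of that of the packet by exactly \<open>c\<close>.

  Plancherel is proved by damping with a Gaussian and letting its width grow
  (\<open>plancherel_regularised\<close>, \<open>plancherel\<close>).
\<close>

section \<open>The Fourier transform and Plancherel's identity\<close>

lemma cmod_exp_imaginary [simp]: "cmod (exp (- \<i> * of_real r)) = 1"
  by (simp add: norm_exp_eq_Re)

lemma borel_measurable_cnj [measurable]: "cnj \<in> borel_measurable borel"
  by (intro borel_measurable_continuous_onI continuous_intros)

lemma fourier_integrable:
  assumes "integrable lborel u"
  shows "integrable lborel (\<lambda>x. u x * exp (- \<i> * of_real (x * p)))"
  by (rule Bochner_Integration.integrable_bound[OF assms])
     (use assms in \<open>auto simp: norm_mult norm_exp_eq_Re intro!: borel_measurable_times\<close>)

lemma fourier_bound:
  assumes "integrable lborel u"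
  shows "cmod (fourier u p) \<le> (LINT x|lborel. cmod (u x))"
proof -
  have "cmod (fourier u p) \<le> (LINT x|lborel. cmod (u x * exp (- \<i> * of_real (x * p))))"
    unfolding fourier_def by (rule integral_norm_bound)
  also have "\<dots> = (LINT x|lborel. cmod (u x))"
    by (simp add: norm_mult norm_exp_eq_Re)
  finally show ?thesis .
qed

lemma fourier_add:
  assumes "integrable lborel u" "integrable lborel v"
  shows "fourier (\<lambda>x. u x + v x) p = fourier u p + fourier v p"
  unfolding fourier_def distrib_right
  by (rule Bochner_Integration.integral_add) (rule fourier_integrable assms)+

lemma fourier_cmult: "fourier (\<lambda>x. c * u x) p = c * fourier u p"
  unfolding fourier_def by (simp add: mult.assoc)

lemma continuous_fourier:
  assumes u: "integrable lborel u"
  shows "continuous_on UNIV (fourier u)"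
proof -
  have [measurable]: "u \<in> borel_measurable borel"
    using borel_measurable_integrable[OF u] by simp
  have "isCont (fourier u) p" for p
    unfolding isCont_def tendsto_at_iff_sequentially comp_def
  proof (intro allI impI)
    fix X :: "nat \<Rightarrow> real" assume X: "X \<longlonglongrightarrow> p"
    show "(\<lambda>n. fourier u (X n)) \<longlonglongrightarrow> fourier u p"
      unfolding fourier_def
    proof (rule integral_dominated_convergence[where w="\<lambda>x. cmod (u x)"])
      show "AE x in lborel. (\<lambda>n. u x * exp (- \<i> * of_real (x * X n))) \<longlonglongrightarrow> u x * exp (- \<i> * of_real (x * p))"
        by (intro AE_I2 tendsto_intros X)
    qed (use u in \<open>auto simp: norm_mult norm_exp_eq_Re\<close>)
  qed
  then show ?thesis by (simp add: continuous_on_eq_continuous_at)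
qed

text \<open>Both sides are the double integral of \<open>a(x) b(p) e\<^sup>-\<^sup>i\<^sup>x\<^sup>p\<close>, which converges absolutely.\<close>

lemma fourier_multiplication_formula:
  assumes a: "integrable lborel a" and b: "integrable lborel b"
  shows "(LINT p|lborel. fourier a p * b p) = (LINT x|lborel. a x * fourier b x)"
proof -
  have [measurable]: "a \<in> borel_measurable borel" "b \<in> borel_measurable borel"
    using borel_measurable_integrable[OF a] borel_measurable_integrable[OF b] by simp_all
  let ?k = "\<lambda>x p. a x * b p * exp (- \<i> * of_real (x * p))"
  have "integrable (lborel \<Otimes>\<^sub>M lborel) (case_prod ?k)"
  proof (rule lborel_pair.Fubini_integrable)
    have "(LINT p|lborel. norm (?k x p)) = cmod (a x) * (LINT p|lborel. cmod (b p))" for x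
      by (simp add: norm_mult norm_exp_eq_Re)
    then show "integrable lborel (\<lambda>x. LINT p|lborel. norm (case (x, p) of (x, p) \<Rightarrow> ?k x p))"
      using a by simp
    show "AE x in lborel. integrable lborel (\<lambda>p. case (x, p) of (x, p) \<Rightarrow> ?k x p)"
    proof (rule AE_I2)
      fix x show "integrable lborel (\<lambda>p. case (x, p) of (x, p) \<Rightarrow> ?k x p)"
        using integrable_mult_right[OF fourier_integrable[OF b, of x], of "a x"]
        by (simp add: mult_ac)
    qed
  qed measurable
  from lborel_pair.Fubini_integral[OF this]
  have "(LINT p|lborel. (LINT x|lborel. ?k x p)) = (LINT x|lborel. (LINT p|lborel. ?k x p))" .
  moreover have "(LINT x|lborel. ?k x p) = fourier a p * b p" for p
    unfolding fourier_def integral_mult_left_zero[symmetric]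
    by (intro Bochner_Integration.integral_cong) (auto simp: mult_ac)
  moreover have "(LINT p|lborel. ?k x p) = a x * fourier b x" for x
    unfolding fourier_def integral_mult_right_zero[symmetric]
    by (intro Bochner_Integration.integral_cong) (auto simp: mult_ac)
  ultimately show ?thesis by simp
qed

text \<open>The transform of the normal density is its characteristic function, again a Gaussian.
  Dilating by \<open>s\<close> and modulating by \<open>y\<close> turns it into \<open>sqrt (2 * pi)\<close> times the
  probability density of width \<open>s\<close> centred at \<open>y\<close>, an approximate identity as \<open>s\<close> tends to \<open>0\<close>.\<close>

lemma fourier_modulated_gaussian:
  assumes s: "s > 0"
  shows "fourier (\<lambda>p. of_real (std_normal_density (s * p)) * exp (\<i> * of_real (y * p))) x
       = of_real (sqrt (2 * pi) / s * std_normal_density ((x - y) / s))"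
proof -
  \<comment> \<open>The substitution \<open>z = s * p\<close> turns the frequency \<open>y - x\<close> into this one.\<close>
  let ?\<tau> = "(y - x) / s"
  let ?h = "\<lambda>z. of_real (std_normal_density z) * exp (\<i> * of_real (?\<tau> * z)) :: complex"
  have "char std_normal_distribution ?\<tau> = (LINT z|lborel. ?h z)"
    unfolding char_def by (subst integral_density) (auto simp: scaleR_conv_of_real)
  also have "\<dots> = s * (LINT p|lborel. ?h (s * p))"
    using s lborel_integral_real_affine[of s ?h 0] by (simp add: scaleR_conv_of_real)
  also have "(LINT p|lborel. ?h (s * p)) = fourier (\<lambda>p. of_real (std_normal_density (s * p)) * exp (\<i> * of_real (y * p))) x"
    unfolding fourier_def
  proof (intro Bochner_Integration.integral_cong refl)
    fix p
    have "?\<tau> * (s * p) = y * p - p * x"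
      using s by (simp add: field_simps)
    then have "\<i> * of_real (?\<tau> * (s * p)) = \<i> * of_real (y * p) + - \<i> * of_real (p * x)"
      by (simp only: of_real_diff) (simp add: right_diff_distrib)
    then show "?h (s * p) = of_real (std_normal_density (s * p)) * exp (\<i> * of_real (y * p)) * exp (- \<i> * of_real (p * x))"
      by (simp only: exp_add mult.assoc)
  qed
  finally have "of_real s * fourier (\<lambda>p. of_real (std_normal_density (s * p)) * exp (\<i> * of_real (y * p))) x
     = of_real (exp (- ?\<tau>\<^sup>2 / 2))"
    unfolding char_std_normal_distribution by simp
  also have "exp (- ?\<tau>\<^sup>2 / 2) = sqrt (2 * pi) * std_normal_density ((x - y) / s)"
    by (simp add: std_normal_density_def power2_eq_square algebra_simps diff_divide_distrib)
  finally show ?thesis using s by (simp add: field_simps)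
qed

lemma integrable_gaussian_dilate:
  assumes "s > 0" shows "integrable lborel (\<lambda>p. std_normal_density (s * p))"
  using lborel_integrable_real_affine[of std_normal_density s 0] assms by simp

text \<open>The Gaussian damping makes \<open>cnj (fourier v)\<close> integrable, so the multiplication formula can
  move both transforms off \<open>v\<close>: the first use leaves \<open>v\<close> paired with the transform of the damped
  function, the second one recognises that transform as \<open>v\<close> averaged over a Gaussian of width \<open>s\<close>.\<close>

lemma plancherel_regularised:
  assumes v: "integrable lborel v" and s: "s > 0"
  shows "of_real (LINT p|lborel. (cmod (fourier v p))\<^sup>2 * std_normal_density (s * p))
       = of_real (sqrt (2 * pi)) *
         (LINT y|lborel. v y * cnj (LINT z|lborel. v (y + s * z) * of_real (std_normal_density z)))"
proof -
  have [measurable]: "v \<in> borel_measurable borel"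
    using borel_measurable_integrable[OF v] by simp
  have [measurable]: "fourier v \<in> borel_measurable borel"
    by (rule borel_measurable_continuous_onI[OF continuous_fourier[OF v]])
  let ?b = "\<lambda>p. cnj (fourier v p) * of_real (std_normal_density (s * p))"
  let ?C = "LINT x|lborel. cmod (v x)"
  have b: "integrable lborel ?b"
  proof (rule Bochner_Integration.integrable_bound)
    show "integrable lborel (\<lambda>p. ?C * std_normal_density (s * p))"
      by (intro integrable_mult_right integrable_gaussian_dilate s)
    show "AE p in lborel. cmod (?b p) \<le> norm (?C * std_normal_density (s * p))"
      using fourier_bound[OF v] by (auto simp: norm_mult abs_mult intro!: AE_I2 mult_right_mono)
  qed simp
  have inner: "fourier ?b y = of_real (sqrt (2 * pi)) * cnj (LINT z|lborel. v (y + s * z) * of_real (std_normal_density z))" for y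
  proof -
    let ?e = "\<lambda>p. of_real (std_normal_density (s * p)) * exp (\<i> * of_real (y * p)) :: complex"
    have e: "integrable lborel ?e"
      by (rule Bochner_Integration.integrable_bound[OF integrable_gaussian_dilate[OF s]])
         (auto simp: norm_mult norm_exp_eq_Re)
    have "cnj (fourier ?b y) = (LINT p|lborel. cnj (?b p * exp (- \<i> * of_real (p * y))))"
      unfolding fourier_def[of ?b] by (rule Bochner_Integration.integral_cnj[symmetric])
    also have "\<dots> = (LINT p|lborel. fourier v p * ?e p)"
      by (simp add: exp_cnj mult_ac)
    also have "\<dots> = (LINT x|lborel. v x * fourier ?e x)"
      by (rule fourier_multiplication_formula[OF v e])
    also have "\<dots> = (LINT x|lborel. v x * of_real (sqrt (2 * pi) / s * std_normal_density ((x - y) / s)))"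
      by (simp only: fourier_modulated_gaussian[OF s])
    also have "\<dots> = of_real s * (LINT z|lborel. v (y + s * z) * of_real (sqrt (2 * pi) / s * std_normal_density z))"
      using s lborel_integral_real_affine[of s "\<lambda>x. v x * of_real (sqrt (2 * pi) / s * std_normal_density ((x - y) / s))" y]
      by (simp add: scaleR_conv_of_real)
    also have "\<dots> = of_real (sqrt (2 * pi)) * (LINT z|lborel. v (y + s * z) * of_real (std_normal_density z))"
      unfolding integral_mult_right_zero[symmetric]
      by (intro Bochner_Integration.integral_cong) (use s in auto)
    finally have "cnj (cnj (fourier ?b y)) = cnj (of_real (sqrt (2 * pi)) * (LINT z|lborel. v (y + s * z) * of_real (std_normal_density z)))"
      by (rule arg_cong)
    then show ?thesis by simp
  qed
  have "of_real (LINT p|lborel. (cmod (fourier v p))\<^sup>2 * std_normal_density (s * p)) = (LINT p|lborel. fourier v p * ?b p)"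
    unfolding integral_complex_of_real[symmetric]
    by (intro Bochner_Integration.integral_cong) (auto simp: complex_norm_square[symmetric] mult.assoc[symmetric] simp del: of_real_power)
  also have "\<dots> = (LINT y|lborel. v y * fourier ?b y)"
    by (rule fourier_multiplication_formula[OF v b])
  also have "\<dots> = of_real (sqrt (2 * pi)) * (LINT y|lborel. v y * cnj (LINT z|lborel. v (y + s * z) * of_real (std_normal_density z)))"
    unfolding inner integral_mult_right_zero[symmetric]
    by (intro Bochner_Integration.integral_cong) auto
  finally show ?thesis .
qed

text \<open>As \<open>s\<close> tends to \<open>0\<close> the averages of \<open>v\<close> converge pointwise by continuity and are dominated by
  the bound \<open>M\<close>, while the damped integrands on the other side increase. Monotone convergence
  therefore also yields the integrability of the square of \<open>fourier v\<close>, with no decay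
  of \<open>fourier v\<close> assumed.\<close>

lemma plancherel:
  assumes v: "integrable lborel v" and cont: "continuous_on UNIV v" and bdd: "\<And>x. cmod (v x) \<le> M"
  shows "integrable lborel (\<lambda>p. (cmod (fourier v p))\<^sup>2)"
    and "(LINT p|lborel. (cmod (fourier v p))\<^sup>2) = 2 * pi * (LINT x|lborel. (cmod (v x))\<^sup>2)"
proof -
  have [measurable]: "v \<in> borel_measurable borel"
    using borel_measurable_integrable[OF v] by simp
  have Fm [measurable]: "fourier v \<in> borel_measurable borel"
    by (rule borel_measurable_continuous_onI[OF continuous_fourier[OF v]])
  \<comment> \<open>Any positive sequence decreasing to 0 serves; monotonicity is needed for monotone convergence.\<close>
  define s where "s n = 1 / (real n + 1)" for n
  have s_pos: "s n > 0" for n by (simp add: s_def)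
  have s_lim: "s \<longlonglongrightarrow> 0"
    unfolding s_def using LIMSEQ_inverse_real_of_nat by (simp add: inverse_eq_divide add.commute)
  have M: "M \<ge> 0" using bdd[of 0] norm_ge_zero order_trans by blast
  define J where "J n y = (LINT z|lborel. v (y + s n * z) * of_real (std_normal_density z))" for n y
  have [measurable]: "J n \<in> borel_measurable borel" for n
    unfolding J_def by measurable
  have J_lim: "(\<lambda>n. J n y) \<longlonglongrightarrow> v y" for y
  proof -
    have "(\<lambda>n. J n y) \<longlonglongrightarrow> (LINT z|lborel. v y * of_real (std_normal_density z))"
      unfolding J_def
    proof (rule integral_dominated_convergence[where w="\<lambda>z. M * std_normal_density z"])
      have "isCont v y" using cont by (simp add: continuous_on_eq_continuous_at)
      moreover have "(\<lambda>n. y + s n * z) \<longlonglongrightarrow> y" for z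
        by (rule tendsto_eq_intros s_lim refl)+ simp
      ultimately have "(\<lambda>n. v (y + s n * z)) \<longlonglongrightarrow> v y" for z
        by (rule isCont_tendsto_compose)
      then show "AE z in lborel. (\<lambda>n. v (y + s n * z) * of_real (std_normal_density z)) \<longlonglongrightarrow> v y * of_real (std_normal_density z)"
        by (intro AE_I2 tendsto_intros)
    qed (auto simp: norm_mult bdd intro!: mult_right_mono)
    also have "(LINT z|lborel. v y * of_real (std_normal_density z)) = v y"
      by simp
    finally show ?thesis .
  qed
  have J_bound: "cmod (J n y) \<le> M" for n y
  proof -
    have "cmod (J n y) \<le> (LINT z|lborel. M * std_normal_density z)"
      unfolding J_def
    proof (rule order_trans[OF integral_norm_bound integral_mono])
      show "integrable lborel (\<lambda>z. norm (v (y + s n * z) * of_real (std_normal_density z)))"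
        by (rule Bochner_Integration.integrable_bound[where f="\<lambda>z. M * std_normal_density z"])
           (auto simp: norm_mult abs_mult M intro!: mult_right_mono bdd)
    qed (auto simp: norm_mult bdd intro!: mult_right_mono)
    then show ?thesis by simp
  qed
  have "(\<lambda>n. of_real (sqrt (2 * pi)) * (LINT y|lborel. v y * cnj (J n y)))
     \<longlonglongrightarrow> of_real (sqrt (2 * pi)) * (LINT y|lborel. v y * cnj (v y))"
  proof (intro tendsto_intros integral_dominated_convergence[where w="\<lambda>y. cmod (v y) * M"])
    show "AE y in lborel. (\<lambda>n. v y * cnj (J n y)) \<longlonglongrightarrow> v y * cnj (v y)"
      by (intro AE_I2 tendsto_intros J_lim)
  qed (use v in \<open>auto simp: norm_mult J_bound intro!: mult_left_mono\<close>)
  moreover have "(LINT y|lborel. v y * cnj (v y)) = of_real (LINT y|lborel. (cmod (v y))\<^sup>2)"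
    unfolding integral_complex_of_real[symmetric] by (simp only: complex_norm_square)
  ultimately have "(\<lambda>n. complex_of_real (LINT p|lborel. (cmod (fourier v p))\<^sup>2 * std_normal_density (s n * p)))
     \<longlonglongrightarrow> of_real (sqrt (2 * pi) * (LINT y|lborel. (cmod (v y))\<^sup>2))"
    unfolding plancherel_regularised[OF v s_pos] J_def by simp
  then have lim: "(\<lambda>n. LINT p|lborel. (cmod (fourier v p))\<^sup>2 * std_normal_density (s n * p))
     \<longlonglongrightarrow> sqrt (2 * pi) * (LINT y|lborel. (cmod (v y))\<^sup>2)"
    unfolding tendsto_of_real_iff .
  let ?u = "\<lambda>p. (cmod (fourier v p))\<^sup>2 * std_normal_density 0"
  have int: "integrable lborel (\<lambda>p. (cmod (fourier v p))\<^sup>2 * std_normal_density (s n * p))" for n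
  proof (rule Bochner_Integration.integrable_bound)
    show "integrable lborel (\<lambda>p. (LINT x|lborel. cmod (v x))\<^sup>2 * std_normal_density (s n * p))"
      by (intro integrable_mult_right integrable_gaussian_dilate s_pos)
  qed (use fourier_bound[OF v] in \<open>auto simp: norm_mult abs_mult intro!: AE_I2 mult_right_mono power_mono\<close>)
  have mono: "mono (\<lambda>n. (cmod (fourier v p))\<^sup>2 * std_normal_density (s n * p))" for p
  proof (intro monoI mult_left_mono)
    fix m n :: nat assume "m \<le> n"
    then have "s n \<le> s m" by (simp add: s_def frac_le)
    then have "(s n * p)\<^sup>2 \<le> (s m * p)\<^sup>2"
      using s_pos[of n] by (simp add: power_mult_distrib mult_right_mono power_mono)
    then show "std_normal_density (s m * p) \<le> std_normal_density (s n * p)"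
      by (simp add: std_normal_density_def divide_right_mono)
  qed simp
  have ptlim: "(\<lambda>n. (cmod (fourier v p))\<^sup>2 * std_normal_density (s n * p)) \<longlonglongrightarrow> ?u p" for p
    unfolding std_normal_density_def
    by (rule tendsto_eq_intros s_lim refl | simp)+
  have u: "integrable lborel ?u" "integral\<^sup>L lborel ?u = sqrt (2 * pi) * (LINT y|lborel. (cmod (v y))\<^sup>2)"
    by (rule integral_monotone_convergence_nonneg[OF int _ _ _ lim]; use mono ptlim in auto)+
  have "integrable lborel (\<lambda>p. ?u p * sqrt (2 * pi))"
    using u(1) by (rule integrable_mult_left)
  then show "integrable lborel (\<lambda>p. (cmod (fourier v p))\<^sup>2)"
    by (simp add: std_normal_density_def)
  have "(LINT p|lborel. (cmod (fourier v p))\<^sup>2) = sqrt (2 * pi) * integral\<^sup>L lborel ?u"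
    by (simp add: std_normal_density_def)
  then show "(LINT p|lborel. (cmod (fourier v p))\<^sup>2) = 2 * pi * (LINT x|lborel. (cmod (v x))\<^sup>2)"
    unfolding u(2) by (simp add: mult.assoc[symmetric])
qed

section \<open>Differentiation and the Fourier transform\<close>

lemma integrable_of_quadratic_decay:
  fixes u :: "real \<Rightarrow> 'a::{banach, second_countable_topology}"
  assumes [measurable]: "u \<in> borel_measurable borel" and bd: "\<And>x. norm (u x) \<le> C / (1 + x\<^sup>2)"
  shows "integrable lborel u"
proof (rule Bochner_Integration.integrable_bound)
  have "integrable lborel (\<lambda>x::real. inverse (1 + x\<^sup>2))"
    using integrable_inverse_1_plus_square by (simp add: set_integrable_def)
  then show "integrable lborel (\<lambda>x::real. C / (1 + x\<^sup>2))"
    by (simp add: divide_inverse)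
  show "AE x in lborel. norm (u x) \<le> norm (C / (1 + x\<^sup>2))"
    by (auto intro!: AE_I2 order_trans[OF bd] divide_right_mono)
qed simp

lemma continuous_compact_support_integrable:
  fixes v :: "real \<Rightarrow> 'a::{banach, second_countable_topology}"
  assumes "continuous_on UNIV v" "\<And>x. x \<notin> {a..b} \<Longrightarrow> v x = 0"
  shows "integrable lborel v"
proof -
  have "integrable lborel (\<lambda>x. indicator {a..b} x *\<^sub>R v x)"
    using assms by (intro borel_integrable_compact) (auto intro: continuous_on_subset)
  also have "(\<lambda>x. indicator {a..b} x *\<^sub>R v x) = v"
    using assms(2) by (auto simp: indicator_def)
  finally show ?thesis .
qed

lemma continuous_compact_support_bounded:
  fixes v :: "real \<Rightarrow> 'a::real_normed_vector"
  assumes "continuous_on UNIV v" "\<And>x. x \<notin> {a..b} \<Longrightarrow> v x = 0"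
  obtains M where "\<And>x. norm (v x) \<le> M"
proof -
  have "bounded (v ` {a..b})"
    using assms(1) by (intro compact_imp_bounded compact_continuous_image) (auto intro: continuous_on_subset)
  then obtain M where M: "\<And>x. x \<in> {a..b} \<Longrightarrow> norm (v x) \<le> M" "M > 0"
    unfolding bounded_pos by blast
  have "norm (v x) \<le> M" for x
    using M assms(2)[of x] by (cases "x \<in> {a..b}") auto
  then show ?thesis by (rule that)
qed

lemma has_vector_derivative_iff_quotient:
  "(f has_vector_derivative f') (at x) \<longleftrightarrow> ((\<lambda>h. (f (x + h) - f x) /\<^sub>R h) \<longlongrightarrow> f') (at 0)"
proof -
  have "(f has_vector_derivative f') (at x) \<longleftrightarrow>
      ((\<lambda>h. norm (f (x + h) - f x - h *\<^sub>R f') / norm h) \<longlongrightarrow> 0) (at 0)"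
    unfolding has_vector_derivative_def has_derivative_at by (simp add: bounded_linear_scaleR_left)
  also have "\<dots> \<longleftrightarrow> ((\<lambda>h. norm ((f (x + h) - f x) /\<^sub>R h - f')) \<longlongrightarrow> 0) (at 0)"
  proof (rule filterlim_cong[OF refl refl])
    have "norm (f (x + h) - f x - h *\<^sub>R f') / norm h = norm ((f (x + h) - f x) /\<^sub>R h - f')" if "h \<noteq> 0" for h
    proof -
      have "(f (x + h) - f x) /\<^sub>R h - f' = (f (x + h) - f x - h *\<^sub>R f') /\<^sub>R h"
        using that by (simp add: scaleR_diff_right)
      then show ?thesis by (simp add: divide_inverse mult.commute)
    qed
    then show "\<forall>\<^sub>F h in at 0. norm (f (x + h) - f x - h *\<^sub>R f') / norm h = norm ((f (x + h) - f x) /\<^sub>R h - f')"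
      by (auto simp: eventually_at_filter)
  qed
  also have "\<dots> \<longleftrightarrow> ((\<lambda>h. (f (x + h) - f x) /\<^sub>R h) \<longlongrightarrow> f') (at 0)"
    by (simp add: tendsto_norm_zero_iff LIM_zero_iff)
  finally show ?thesis .
qed

lemma norm_exp_imaginary_minus_one_le: "cmod (exp (- \<i> * of_real r) - 1) \<le> \<bar>r\<bar>"
proof -
  have "cmod (exp (\<i> * of_real (- r)) - (\<Sum>k\<le>0. (\<i> * of_real (- r)) ^ k / fact k)) \<le> \<bar>- r\<bar> ^ Suc 0 / fact (Suc 0)"
    by (rule iexp_approx1)
  then show ?thesis by simp
qed

text \<open>Differentiation under the integral sign: the difference quotients of the exponential are
  bounded by \<open>\<bar>x\<bar>\<close>, so \<open>\<bar>x * u x\<bar>\<close> dominates.\<close>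

lemma fourier_has_vector_derivative:
  assumes u: "integrable lborel u" and xu: "integrable lborel (\<lambda>x. of_real x * u x)"
  shows "(fourier u has_vector_derivative fourier (\<lambda>x. - \<i> * (of_real x * u x)) p) (at p)"
proof -
  have [measurable]: "u \<in> borel_measurable borel"
    using borel_measurable_integrable[OF u] by simp
  let ?q = "\<lambda>h x. u x * exp (- \<i> * of_real (x * p)) * ((exp (- \<i> * of_real (x * h)) - 1) / of_real h)"
  have quot: "(fourier u (p + h) - fourier u p) /\<^sub>R h = (LINT x|lborel. ?q h x)" for h
  proof -
    have "fourier u (p + h) - fourier u p
      = (LINT x|lborel. u x * exp (- \<i> * of_real (x * (p + h))) - u x * exp (- \<i> * of_real (x * p)))"
      unfolding fourier_def by (rule Bochner_Integration.integral_diff[symmetric]) (rule fourier_integrable u)+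
    then have "(fourier u (p + h) - fourier u p) /\<^sub>R h
      = (LINT x|lborel. (u x * exp (- \<i> * of_real (x * (p + h))) - u x * exp (- \<i> * of_real (x * p))) /\<^sub>R h)"
      by simp
    also have "\<dots> = (LINT x|lborel. ?q h x)"
      by (intro Bochner_Integration.integral_cong)
         (auto simp: scaleR_conv_of_real divide_inverse algebra_simps exp_add exp_diff exp_minus)
    finally show ?thesis .
  qed
  have "((\<lambda>h. (fourier u (p + h) - fourier u p) /\<^sub>R h) \<longlongrightarrow> fourier (\<lambda>x. - \<i> * (of_real x * u x)) p) (at 0)"
    unfolding tendsto_at_iff_sequentially comp_def quot
  proof (intro allI impI)
    fix X :: "nat \<Rightarrow> real" assume X: "\<forall>i. X i \<in> UNIV - {0}" "X \<longlonglongrightarrow> 0"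
    show "(\<lambda>n. LINT x|lborel. ?q (X n) x) \<longlonglongrightarrow> fourier (\<lambda>x. - \<i> * (of_real x * u x)) p"
      unfolding fourier_def
    proof (rule integral_dominated_convergence[where w="\<lambda>x. cmod (of_real x * u x)"])
      have "(\<lambda>n. ?q (X n) x) \<longlonglongrightarrow> u x * exp (- \<i> * of_real (x * p)) * (- \<i> * of_real x)" for x
      proof (intro tendsto_intros)
        have "((\<lambda>h::real. (exp (- \<i> * of_real (x * h)) - 1) / of_real h) \<longlongrightarrow> - \<i> * of_real x) (at 0)"
          using exp_scaleR_has_vector_derivative_right[of "- \<i> * of_real x" 0 UNIV]
          by (simp add: has_vector_derivative_iff_quotient scaleR_conv_of_real divide_inverse mult_ac)
        then show "(\<lambda>n. (exp (- \<i> * of_real (x * X n)) - 1) / of_real (X n)) \<longlonglongrightarrow> - \<i> * of_real x"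
          unfolding tendsto_at_iff_sequentially comp_def using X by blast
      qed
      then show "AE x in lborel. (\<lambda>n. ?q (X n) x) \<longlonglongrightarrow> - \<i> * (of_real x * u x) * exp (- \<i> * of_real (x * p))"
        by (intro AE_I2) (simp add: mult_ac)
      show "AE x in lborel. cmod (?q (X n) x) \<le> cmod (of_real x * u x)" for n
      proof (intro AE_I2)
        fix x
        have "cmod (exp (- \<i> * of_real (x * X n)) - 1) \<le> \<bar>x * X n\<bar>"
          by (rule norm_exp_imaginary_minus_one_le)
        then have "cmod ((exp (- \<i> * of_real (x * X n)) - 1) / of_real (X n)) \<le> \<bar>x\<bar>"
          using X(1) by (simp add: norm_divide divide_le_eq abs_mult del: of_real_mult)
        then have "cmod (?q (X n) x) \<le> cmod (u x) * 1 * \<bar>x\<bar>"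
          unfolding norm_mult cmod_exp_imaginary by (intro mult_left_mono) auto
        then show "cmod (?q (X n) x) \<le> cmod (of_real x * u x)"
          by (simp add: norm_mult mult.commute)
      qed
    qed (use xu in auto)
  qed
  then show ?thesis
    unfolding has_vector_derivative_iff_quotient .
qed

text \<open>Integration by parts; the boundary terms vanish with \<open>v\<close>.\<close>

lemma fourier_of_derivative:
  assumes deriv: "\<And>x. (v has_vector_derivative v' x) (at x)"
    and cont: "continuous_on UNIV v'"
    and supp: "\<And>x. x \<notin> {a..b} \<Longrightarrow> v x = 0" "\<And>x. x \<notin> {a..b} \<Longrightarrow> v' x = 0"
  shows "fourier v' x = \<i> * of_real x * fourier v x"
proof (cases "a \<le> b")
  case True
  have cont0: "continuous_on UNIV v"
    by (intro continuous_at_imp_continuous_on ballI has_vector_derivative_continuous[OF deriv])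
  let ?e = "\<lambda>p. exp (- \<i> * of_real (p * x))"
  let ?d = "\<lambda>p. v' p * ?e p - \<i> * of_real x * (v p * ?e p)"
  have int: "integrable lborel v" "integrable lborel v'"
    using continuous_compact_support_integrable cont cont0 supp by blast+
  \<comment> \<open>The interval is enlarged because the support condition forces \<open>v\<close> to vanish only outside \<open>{a..b}\<close>.\<close>
  have "(LINT p|lborel. indicator {a-1..b+1} p *\<^sub>R ?d p) = v (b+1) * ?e (b+1) - v (a-1) * ?e (a-1)"
  proof (rule integral_FTC_atLeastAtMost)
    show "((\<lambda>p. v p * ?e p) has_vector_derivative ?d p) (at p within {a-1..b+1})" for p
    proof -
      have "(?e has_vector_derivative (- \<i> * of_real x) * ?e p) (at p)"
        using exp_scaleR_has_vector_derivative_right[of "- \<i> * of_real x" p UNIV]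
        by (simp add: scaleR_conv_of_real mult_ac)
      from has_vector_derivative_mult[OF deriv this]
      have "((\<lambda>p. v p * ?e p) has_vector_derivative (v p * ((- \<i> * of_real x) * ?e p) + v' p * ?e p)) (at p)" .
      moreover have "v p * ((- \<i> * of_real x) * E) + v' p * E = v' p * E - \<i> * of_real x * (v p * E)" for E
        by (simp add: algebra_simps)
      ultimately show ?thesis
        by (simp only: has_vector_derivative_at_within)
    qed
    show "continuous_on {a - 1..b + 1} ?d"
      by (intro continuous_intros continuous_on_subset[OF cont] continuous_on_subset[OF cont0]) auto
  qed (use True in auto)
  also have "\<dots> = 0" using supp by simp
  also have "(\<lambda>p. indicator {a-1..b+1} p *\<^sub>R ?d p) = ?d"
    using supp by (auto simp: indicator_def fun_eq_iff)
  also have "(LINT p|lborel. ?d p) = fourier v' x - \<i> * of_real x * fourier v x"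
    unfolding fourier_def integral_mult_right_zero[symmetric]
    by (intro Bochner_Integration.integral_diff integrable_mult_right fourier_integrable int)
  finally show ?thesis by simp
next
  case False
  then have "v = (\<lambda>_. 0)" "v' = (\<lambda>_. 0)" using supp by (auto simp: fun_eq_iff)
  then show ?thesis by (simp add: fourier_def)
qed

text \<open>Multiplying \<open>fourier v\<close> by \<open>x\<close> amounts to replacing \<open>v\<close> by \<open>-\<i> v'\<close>, so the second moment is
  Plancherel for \<open>v'\<close>. The first moment is an inner product; polarisation reduces it to
  Plancherel for \<open>v\<close>, \<open>v'\<close> and \<open>v - \<i> v'\<close>.\<close>

lemma fourier_position_moments:
  fixes v v' :: "real \<Rightarrow> complex"
  assumes deriv: "\<And>x. (v has_vector_derivative v' x) (at x)"
    and cont: "continuous_on UNIV v'"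
    and supp: "\<And>x. x \<notin> {a..b} \<Longrightarrow> v x = 0" "\<And>x. x \<notin> {a..b} \<Longrightarrow> v' x = 0"
  shows "(LINT x|lborel. x\<^sup>2 * (cmod (fourier v x))\<^sup>2) = 2 * pi * (LINT p|lborel. (cmod (v' p))\<^sup>2)"
    and "(LINT x|lborel. x * (cmod (fourier v x))\<^sup>2) = 2 * pi * (LINT p|lborel. Im (v' p * cnj (v p)))"
proof -
  have cont0: "continuous_on UNIV v"
    by (intro continuous_at_imp_continuous_on ballI has_vector_derivative_continuous[OF deriv])
  have planch: "integrable lborel (\<lambda>p. (cmod (fourier w p))\<^sup>2)"
    "(LINT p|lborel. (cmod (fourier w p))\<^sup>2) = 2 * pi * (LINT x|lborel. (cmod (w x))\<^sup>2)"
    if w: "continuous_on UNIV w" "\<And>x. x \<notin> {a..b} \<Longrightarrow> w x = 0" for w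
  proof -
    obtain M where "\<And>x. norm (w x) \<le> M"
      using continuous_compact_support_bounded[OF w] by blast
    then show "integrable lborel (\<lambda>p. (cmod (fourier w p))\<^sup>2)"
      "(LINT p|lborel. (cmod (fourier w p))\<^sup>2) = 2 * pi * (LINT x|lborel. (cmod (w x))\<^sup>2)"
      using plancherel continuous_compact_support_integrable[OF w] w(1) by blast+
  qed
  have F': "fourier v' x = \<i> * of_real x * fourier v x" for x
    by (rule fourier_of_derivative[OF deriv cont supp])
  let ?w = "\<lambda>p. v p + (- \<i>) * v' p"
  have Fw: "fourier ?w x = (1 + of_real x) * fourier v x" for x
    using continuous_compact_support_integrable[OF cont supp(2)]
      continuous_compact_support_integrable[OF cont0 supp(1)]
    by (subst fourier_add) (simp_all only: fourier_cmult F' integrable_mult_right, simp add: algebra_simps)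
  note P0 = planch[OF cont0 supp(1)] and P1 = planch[OF cont supp(2)]
  have P1': "integrable lborel (\<lambda>x. x\<^sup>2 * (cmod (fourier v x))\<^sup>2)"
    using P1(1) by (simp add: F' norm_mult power_mult_distrib)
  show sq: "(LINT x|lborel. x\<^sup>2 * (cmod (fourier v x))\<^sup>2) = 2 * pi * (LINT p|lborel. (cmod (v' p))\<^sup>2)"
    using P1(2) by (simp add: F' norm_mult power_mult_distrib)
  have P2: "integrable lborel (\<lambda>p. (cmod (fourier ?w p))\<^sup>2)"
    "(LINT p|lborel. (cmod (fourier ?w p))\<^sup>2) = 2 * pi * (LINT x|lborel. (cmod (?w x))\<^sup>2)"
    by (rule planch; use supp in \<open>simp add: cont cont0 continuous_intros\<close>)+
  have split_x: "x * (cmod (fourier v x))\<^sup>2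
      = ((cmod (fourier ?w x))\<^sup>2 - (cmod (fourier v x))\<^sup>2 - x\<^sup>2 * (cmod (fourier v x))\<^sup>2) / 2" for x
  proof -
    have "(cmod (1 + of_real x))\<^sup>2 = (1 + x)\<^sup>2"
      by (metis norm_of_real of_real_1 of_real_add power2_abs)
    then show ?thesis
      unfolding Fw norm_mult power_mult_distrib by (simp add: power2_eq_square algebra_simps)
  qed
  have split_p: "Im (v' p * cnj (v p)) = ((cmod (?w p))\<^sup>2 - (cmod (v p))\<^sup>2 - (cmod (v' p))\<^sup>2) / 2" for p
    unfolding cmod_power2 by (simp add: power2_eq_square algebra_simps)
  have ints: "integrable lborel (\<lambda>p. (cmod (?w p))\<^sup>2)" "integrable lborel (\<lambda>p. (cmod (v p))\<^sup>2)"
    "integrable lborel (\<lambda>p. (cmod (v' p))\<^sup>2)"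
    by (rule continuous_compact_support_integrable[of _ a b];
        use supp in \<open>simp add: cont cont0 continuous_intros\<close>)+
  show "(LINT x|lborel. x * (cmod (fourier v x))\<^sup>2) = 2 * pi * (LINT p|lborel. Im (v' p * cnj (v p)))"
    unfolding split_x split_p using P0 P1' P2 sq ints by (simp add: algebra_simps)
qed

section \<open>Mean and variance of a dispersive wave packet\<close>

text \<open>The momentum-space data of a wave packet: \<open>g\<close> stands for the Fourier transform of the initial
  state and \<open>f\<close> for the symbol. The mass \<open>2\<pi>\<close> is that of a normalised initial state.\<close>

locale dispersive_packet =
  fixes a b :: real and g g' :: "real \<Rightarrow> complex" and f f' f'' :: "real \<Rightarrow> real"
  assumes a_less_b: "a < b"
    and g_deriv: "\<And>p. (g has_vector_derivative g' p) (at p)"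
    and g'_cont: "continuous_on UNIV g'"
    and g_supp: "\<And>p. p \<notin> {a..b} \<Longrightarrow> g p = 0"
    and g_mass: "(LINT p|lborel. (cmod (g p))\<^sup>2) = 2 * pi"
    and f_deriv: "\<And>p. (f has_real_derivative f' p) (at p)"
    and f'_deriv: "\<And>p. (f' has_real_derivative f'' p) (at p)"
    and f''_cont: "continuous_on UNIV f''"
    and f''_pos: "\<And>p. f'' p > 0"
begin

lemma g_cont: "continuous_on UNIV g"
  by (intro continuous_at_imp_continuous_on ballI has_vector_derivative_continuous[OF g_deriv])

lemma f_cont: "continuous_on UNIV f" and f'_cont: "continuous_on UNIV f'"
  using f_deriv f'_deriv by (auto intro!: continuous_at_imp_continuous_on DERIV_isCont)

lemma g'_supp:
  assumes "p \<notin> {a..b}" shows "g' p = 0"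
proof (rule vector_derivative_unique_at)
  show "(g has_vector_derivative g' p) (at p)" by (rule g_deriv)
  show "(g has_vector_derivative 0) (at p)"
    by (rule has_vector_derivative_transform_within_open[OF has_vector_derivative_const, of "- {a..b}"])
       (use assms g_supp in auto)
qed

lemma f'_strict_mono: "strict_mono f'"
  using DERIV_pos_imp_increasing f'_deriv f''_pos by (intro strict_monoI) blast

text \<open>Expectation with respect to the momentum distribution, whose density is
  \<open>\<bar>g\<bar>\<^sup>2 / (2\<pi>)\<close>.\<close>

definition mean :: "(real \<Rightarrow> real) \<Rightarrow> real" where
  "mean h = (LINT p|lborel. h p * (cmod (g p))\<^sup>2) / (2 * pi)"

definition velocity :: real where "velocity = mean f'"

definition dispersion :: real where "dispersion = mean (\<lambda>p. (f' p - velocity)\<^sup>2)"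

lemma mean_integrable:
  assumes "continuous_on UNIV h" shows "integrable lborel (\<lambda>p. h p * (cmod (g p))\<^sup>2)"
  by (rule continuous_compact_support_integrable[of _ a b])
     (auto simp: g_supp intro!: continuous_intros assms g_cont)

lemma mean_add:
  "continuous_on UNIV h \<Longrightarrow> continuous_on UNIV k \<Longrightarrow> mean (\<lambda>p. h p + k p) = mean h + mean k"
  unfolding mean_def by (simp add: distrib_right mean_integrable add_divide_distrib)

lemma mean_cmult: "mean (\<lambda>p. c * h p) = c * mean h"
  unfolding mean_def by (simp add: mult.assoc)

lemma mean_const: "mean (\<lambda>p. c) = c"
  unfolding mean_def by (simp add: g_mass)

lemma mean_affine_velocity: "mean (\<lambda>p. x + c * f' p) = x + c * velocity"
  by (simp add: mean_add mean_const mean_cmult velocity_def f'_cont continuous_intros)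

lemma variance_affine_velocity:
  "mean (\<lambda>p. (x + c * f' p)\<^sup>2) - (mean (\<lambda>p. x + c * f' p))\<^sup>2 = c\<^sup>2 * dispersion"
proof -
  have expand: "mean (\<lambda>p. (x + c * f' p)\<^sup>2) = x\<^sup>2 + 2 * x * c * velocity + c\<^sup>2 * mean (\<lambda>p. (f' p)\<^sup>2)" for x c
  proof -
    have "(\<lambda>p. (x + c * f' p)\<^sup>2) = (\<lambda>p. x\<^sup>2 + (2 * x * c * f' p + c\<^sup>2 * (f' p)\<^sup>2))"
      by (simp add: fun_eq_iff power2_eq_square algebra_simps)
    then show ?thesis
      by (simp add: mean_add mean_const mean_cmult velocity_def f'_cont continuous_intros)
  qed
  have D: "mean (\<lambda>p. (f' p)\<^sup>2) = dispersion + velocity\<^sup>2"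
    unfolding dispersion_def using expand[of "- velocity" 1]
    by (simp add: power2_eq_square add.commute)
  show ?thesis
    unfolding expand mean_affine_velocity D by (simp add: power2_eq_square algebra_simps)
qed

text \<open>The velocity \<open>f'\<close> is injective, so it equals its mean at one momentum at most; if its variance
  were \<open>0\<close>, then \<open>g\<close> would vanish almost everywhere.\<close>

lemma dispersion_pos: "dispersion > 0"
proof -
  let ?h = "\<lambda>p. (f' p - velocity)\<^sup>2 * (cmod (g p))\<^sup>2"
  have int: "integrable lborel ?h"
    by (intro mean_integrable continuous_intros f'_cont)
  have "integral\<^sup>L lborel ?h \<noteq> 0"
  proof
    assume "integral\<^sup>L lborel ?h = 0"
    then have ae: "AE p in lborel. ?h p = 0"
      by (subst (asm) integral_nonneg_eq_0_iff_AE[OF int]) auto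
    have "AE p in lborel. f' p \<noteq> velocity"
    proof -
      have "{p. f' p = velocity} \<subseteq> {inv f' velocity}"
      proof
        fix p assume "p \<in> {p. f' p = velocity}"
        then show "p \<in> {inv f' velocity}"
          using inv_f_f[OF strict_mono_imp_inj_on[OF f'_strict_mono], of p] by simp
      qed
      then have "countable {p. f' p = velocity}"
        by (rule countable_subset) simp
      then have "{p. f' p = velocity} \<in> null_sets lborel"
        by (rule countable_imp_null_set_lborel)
      from AE_not_in[OF this] show ?thesis by simp
    qed
    with ae have "AE p in lborel. (cmod (g p))\<^sup>2 = 0"
      by eventually_elim auto
    then have "(LINT p|lborel. (cmod (g p))\<^sup>2) = 0"
      by (rule integral_eq_zero_AE)
    then show False using g_mass by simp
  qed
  moreover have "integral\<^sup>L lborel ?h \<ge> 0" by simp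
  ultimately show ?thesis
    unfolding dispersion_def mean_def by (simp add: order_less_le)
qed

definition amplitude :: "real \<Rightarrow> real \<Rightarrow> complex" where
  "amplitude t p = g p * exp (- \<i> * of_real (t * f p))"

definition packet :: "real \<Rightarrow> real \<Rightarrow> complex" where
  "packet t x = fourier (amplitude t) (- x) / (2 * of_real pi)"

lemma amplitude_deriv:
  "(amplitude t has_vector_derivative (g' p - \<i> * of_real (t * f' p) * g p) * exp (- \<i> * of_real (t * f p))) (at p)"
proof -
  let ?e = "\<lambda>p. exp (- \<i> * of_real (t * f p))"
  have "((\<lambda>y. exp (y *\<^sub>R (- \<i>))) \<circ> (\<lambda>p. t * f p) has_vector_derivative
      (t * f' p) *\<^sub>R (exp ((t * f p) *\<^sub>R (- \<i>)) * (- \<i>))) (at p)"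
  proof (rule vector_diff_chain_at)
    show "((\<lambda>p. t * f p) has_vector_derivative t * f' p) (at p)"
      using DERIV_cmult[OF f_deriv] by (simp add: has_real_derivative_iff_has_vector_derivative)
  qed (rule exp_scaleR_has_vector_derivative_right)
  then have "(?e has_vector_derivative (of_real (t * f' p) * (- \<i>) * ?e p)) (at p)"
    by (simp add: o_def scaleR_conv_of_real mult_ac)
  from has_vector_derivative_mult[OF g_deriv this]
  have "(amplitude t has_vector_derivative (g p * (of_real (t * f' p) * (- \<i>) * ?e p) + g' p * ?e p)) (at p)"
    unfolding amplitude_def[abs_def] .
  moreover have "g p * (of_real (t * f' p) * (- \<i>) * E) + g' p * E = (g' p - \<i> * of_real (t * f' p) * g p) * E" for E
    by (simp add: algebra_simps)
  ultimately show ?thesis by (simp only:)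
qed

text \<open>The mean position at time \<open>0\<close>, written on the momentum side.\<close>

definition center :: real where "center = - (LINT p|lborel. Im (g' p * cnj (g p))) / (2 * pi)"

text \<open>The phase \<open>e\<^sup>-\<^sup>i\<^sup>t\<^sup>f\<close> cancels in both densities and survives only
  through its derivative \<open>-\<i> t f'\<close>; this is what makes the moments polynomial in \<open>t\<close>.\<close>

lemma packet_moments:
  "moment1 (packet t) = - (LINT p|lborel. Im ((g' p - \<i> * of_real (t * f' p) * g p) * cnj (g p))) / (2 * pi)"
  "moment2 (packet t) = (LINT p|lborel. (cmod (g' p - \<i> * of_real (t * f' p) * g p))\<^sup>2) / (2 * pi)"
proof -
  let ?E = "\<lambda>p. exp (- \<i> * of_real (t * f p))"
  let ?d = "\<lambda>p. g' p - \<i> * of_real (t * f' p) * g p"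
  have cont: "continuous_on UNIV (\<lambda>p. ?d p * ?E p)"
    by (intro continuous_intros g'_cont f'_cont g_cont f_cont)
  have cancel: "?d p * ?E p * cnj (amplitude t p) = ?d p * cnj (g p)" for p
    by (simp add: amplitude_def exp_cnj mult.assoc exp_minus)
  note moments = fourier_position_moments[OF amplitude_deriv cont, of a b]
  have supp: "amplitude t p = 0" "?d p * ?E p = 0" if "p \<notin> {a..b}" for p
    using g_supp[OF that] g'_supp[OF that] by (simp_all add: amplitude_def)
  \<comment> \<open>The packet is an inverse transform, hence a transform evaluated at \<open>- x\<close>; this flips the sign of the first moment.\<close>
  have reflect: "(LINT x|lborel. h (- x)) = (LINT x|lborel. h x)" for h :: "real \<Rightarrow> real"
    using lborel_integral_real_affine[of "-1" h 0] by simp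
  have m1: "moment1 (packet t) = - (LINT x|lborel. x * (cmod (fourier (amplitude t) x))\<^sup>2) / (4 * pi\<^sup>2)"
  proof -
    have "(LINT x|lborel. x * (cmod (fourier (amplitude t) (- x)))\<^sup>2)
        = - (LINT x|lborel. x * (cmod (fourier (amplitude t) x))\<^sup>2)"
      using reflect[of "\<lambda>x. x * (cmod (fourier (amplitude t) x))\<^sup>2"] by simp
    then show ?thesis
      by (simp add: moment1_def packet_def norm_divide norm_mult power_divide power_mult_distrib)
  qed
  have m2: "moment2 (packet t) = (LINT x|lborel. x\<^sup>2 * (cmod (fourier (amplitude t) x))\<^sup>2) / (4 * pi\<^sup>2)"
    using reflect[of "\<lambda>x. x\<^sup>2 * (cmod (fourier (amplitude t) x))\<^sup>2"]
    by (simp add: moment2_def packet_def norm_divide norm_mult power_divide power_mult_distrib)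
  have scale: "2 * pi * I / (4 * pi\<^sup>2) = I / (2 * pi)" for I :: real
    by (simp add: power2_eq_square)
  have "(LINT x|lborel. x * (cmod (fourier (amplitude t) x))\<^sup>2)
      = 2 * pi * (LINT p|lborel. Im (?d p * ?E p * cnj (amplitude t p)))"
    by (rule moments(2)[OF supp])
  then show "moment1 (packet t) = - (LINT p|lborel. Im (?d p * cnj (g p))) / (2 * pi)"
    by (simp only: m1 cancel scale minus_divide_left[symmetric])
  have "(LINT x|lborel. x\<^sup>2 * (cmod (fourier (amplitude t) x))\<^sup>2)
      = 2 * pi * (LINT p|lborel. (cmod (?d p * ?E p))\<^sup>2)"
    by (rule moments(1)[OF supp])
  then show "moment2 (packet t) = (LINT p|lborel. (cmod (?d p))\<^sup>2) / (2 * pi)"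
    by (simp only: m2 norm_mult cmod_exp_imaginary mult_1_right scale)
qed

lemma moment1_packet: "moment1 (packet t) = center + t * velocity"
proof -
  have "Im ((g' p - \<i> * of_real (t * f' p) * g p) * cnj (g p)) = Im (g' p * cnj (g p)) - t * (f' p * (cmod (g p))\<^sup>2)" for p
    unfolding cmod_power2 by (simp add: power2_eq_square algebra_simps)
  moreover have "integrable lborel (\<lambda>p. Im (g' p * cnj (g p)))"
    by (rule continuous_compact_support_integrable[of _ a b])
       (auto simp: g_supp intro!: continuous_intros g'_cont g_cont)
  ultimately show ?thesis
    unfolding packet_moments center_def velocity_def mean_def
    by (simp add: mean_integrable f'_cont diff_divide_distrib)
qed

text \<open>Only the leading coefficient matters: the other two are absorbed in the vertex of the parabola.\<close>

lemma moment2_packet: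
  obtains A B where "\<And>t. moment2 (packet t) = A + B * t + t\<^sup>2 * mean (\<lambda>p. (f' p)\<^sup>2)"
proof -
  let ?I = "\<lambda>p. f' p * Im (g' p * cnj (g p))"
  have norm_eq: "(cmod (g' p - \<i> * of_real (t * f' p) * g p))\<^sup>2
      = (cmod (g' p))\<^sup>2 + (- 2 * t) * ?I p + t\<^sup>2 * ((f' p)\<^sup>2 * (cmod (g p))\<^sup>2)" for t p
    unfolding cmod_power2 by (simp add: power2_eq_square algebra_simps)
  have "integrable lborel ?I" "integrable lborel (\<lambda>p. (cmod (g' p))\<^sup>2)"
    by (rule continuous_compact_support_integrable[of _ a b];
        auto simp: g_supp g'_supp intro!: continuous_intros f'_cont g'_cont g_cont)+
  moreover have "integrable lborel (\<lambda>p. (f' p)\<^sup>2 * (cmod (g p))\<^sup>2)"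
    by (intro mean_integrable continuous_intros f'_cont)
  ultimately have "moment2 (packet t) = (LINT p|lborel. (cmod (g' p))\<^sup>2) / (2 * pi)
      + (- (LINT p|lborel. ?I p) / pi) * t + t\<^sup>2 * mean (\<lambda>p. (f' p)\<^sup>2)" for t
    unfolding packet_moments norm_eq mean_def
    by (simp add: add_divide_distrib diff_divide_distrib del: times_complex.sel)
  then show ?thesis by (rule that)
qed

text \<open>The leading coefficient of the second moment, reduced by the square of the mean velocity, is the
  variance of the velocity; the rest is completing the square.\<close>

lemma Var_packet_parabola:
  obtains \<tau> c where "\<And>t. Var (packet t) = dispersion * (t - \<tau>)\<^sup>2 + c"
proof -
  obtain A B where AB: "\<And>t. moment2 (packet t) = A + B * t + t\<^sup>2 * mean (\<lambda>p. (f' p)\<^sup>2)"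
    using moment2_packet by blast
  have D: "mean (\<lambda>p. (f' p)\<^sup>2) = dispersion + velocity\<^sup>2"
    using variance_affine_velocity[of 0 1] mean_affine_velocity[of 0 1] by simp
  let ?\<beta> = "B - 2 * center * velocity"
  have "Var (packet t) = dispersion * (t - - ?\<beta> / (2 * dispersion))\<^sup>2
      + (A - center\<^sup>2 - ?\<beta>\<^sup>2 / (4 * dispersion))" for t
    unfolding Var_def AB moment1_packet D using dispersion_pos
    by (simp add: power2_eq_square field_simps)
  then show ?thesis by (rule that)
qed

subsection \<open>Transport of the momentum distribution by classical trajectories\<close>

text \<open>The density at time \<open>c\<close> of classical particles which start at \<open>x\<^sub>0\<close> with a random momentum
  \<open>p\<close>, distributed as above, and move with constant velocity \<open>f' p\<close>.\<close>

definition classical_profile :: "real \<Rightarrow> real \<Rightarrow> real \<Rightarrow> real" where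
  "classical_profile x\<^sub>0 c x =
    (if (x - x\<^sub>0) / c \<in> range f'
     then (let p = inv f' ((x - x\<^sub>0) / c) in (cmod (g p))\<^sup>2 / (2 * pi * f'' p * \<bar>c\<bar>)) else 0)"

text \<open>The substitution \<open>x = x\<^sub>0 + c * f' p\<close>, made in two steps: an affine one, which
  covers both signs of \<open>c\<close>, and then \<open>y = f' p\<close>, whose Jacobian \<open>f''\<close> cancels the denominator
  of the profile.\<close>

lemma integral_classical_profile:
  assumes h: "continuous_on UNIV h" and c: "c \<noteq> 0"
  shows "(LINT x|lborel. h x * classical_profile x\<^sub>0 c x) = mean (\<lambda>p. h (x\<^sub>0 + c * f' p))"
proof -
  have inj: "inj f'" by (rule strict_mono_imp_inj_on[OF f'_strict_mono])
  let ?k = "\<lambda>y. h (x\<^sub>0 + c * y) * (classical_profile x\<^sub>0 c (x\<^sub>0 + c * y) * \<bar>c\<bar>)"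
  have k_f': "?k (f' p) = h (x\<^sub>0 + c * f' p) * ((cmod (g p))\<^sup>2 / (2 * pi * f'' p))" for p
    using c by (simp add: classical_profile_def inv_f_f[OF inj])
  have image: "f' ` {a..b} = {f' a..f' b}"
  proof
    show "f' ` {a..b} \<subseteq> {f' a..f' b}"
      by (auto simp: strict_mono_less_eq[OF f'_strict_mono])
    show "{f' a..f' b} \<subseteq> f' ` {a..b}"
    proof
      fix y assume "y \<in> {f' a..f' b}"
      then obtain p where "a \<le> p" "p \<le> b" "f' p = y"
        using IVT'[of f' a y b, OF _ _ _ continuous_on_subset[OF f'_cont]] a_less_b by auto
      then show "y \<in> f' ` {a..b}" by auto
    qed
  qed
  have k_supp: "?k y = 0" if "y \<notin> {f' a..f' b}" for y
  proof (cases "y \<in> range f'")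
    case True
    then obtain p where p: "y = f' p" by auto
    then have "p \<notin> {a..b}" using that image by blast
    then show ?thesis unfolding p k_f' by (simp add: g_supp)
  qed (use c in \<open>simp add: classical_profile_def\<close>)
  have k_cont: "continuous_on {f' a..f' b} ?k"
  proof -
    have "continuous_on (f' ` {a..b}) (inv f')"
      by (rule continuous_on_inv) (use inj in \<open>auto simp: inv_f_f intro: continuous_on_subset[OF f'_cont]\<close>)
    then have q: "continuous_on {f' a..f' b} (inv f')" unfolding image .
    have "continuous_on {f' a..f' b} (\<lambda>y. h (x\<^sub>0 + c * y) * ((cmod (g (inv f' y)))\<^sup>2 / (2 * pi * f'' (inv f' y))))"
      by (intro continuous_intros continuous_on_compose2[OF h] continuous_on_compose2[OF g_cont q]
            continuous_on_compose2[OF f''_cont q])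
         (use f''_pos in \<open>auto simp: less_imp_neq[symmetric]\<close>)
    moreover have "?k y = h (x\<^sub>0 + c * y) * ((cmod (g (inv f' y)))\<^sup>2 / (2 * pi * f'' (inv f' y)))"
      if y: "y \<in> {f' a..f' b}" for y
    proof -
      obtain p where "y = f' p" using y image by blast
      then show ?thesis using k_f'[of p] by (simp add: inv_f_f[OF inj])
    qed
    ultimately show ?thesis by (rule continuous_on_eq[OF _ sym])
  qed
  have "(LINT x|lborel. h x * classical_profile x\<^sub>0 c x) = (LINT y|lborel. ?k y)"
    using lborel_integral_real_affine[OF c, of "\<lambda>x. h x * classical_profile x\<^sub>0 c x" x\<^sub>0]
    by (simp add: mult_ac)
  also have "\<dots> = (LINT y|lborel. ?k y * indicator {f' a..f' b} y)"
  proof (intro Bochner_Integration.integral_cong refl)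
    fix y
    show "?k y = ?k y * indicator {f' a..f' b} y"
    proof (cases "y \<in> {f' a..f' b}")
      case True
      then show ?thesis by (simp only: indicator_simps mult_1_right)
    next
      case False
      show ?thesis by (simp only: k_supp[OF False] mult_zero_left)
    qed
  qed
  also have "\<dots> = (LINT p|lborel. ?k (f' p) * f'' p * indicator {a..b} p)"
    by (rule integral_substitution)
       (use a_less_b in \<open>auto intro!: borel_integrable_atLeastAtMost' k_cont f'_deriv less_imp_le[OF f''_pos]
          intro: continuous_on_subset[OF f''_cont]\<close>)
  also have "\<dots> = (LINT p|lborel. h (x\<^sub>0 + c * f' p) * (cmod (g p))\<^sup>2 / (2 * pi))"
    unfolding k_f'
  proof (intro Bochner_Integration.integral_cong refl)
    fix p
    show "h (x\<^sub>0 + c * f' p) * ((cmod (g p))\<^sup>2 / (2 * pi * f'' p)) * f'' p * indicator {a..b} p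
        = h (x\<^sub>0 + c * f' p) * (cmod (g p))\<^sup>2 / (2 * pi)"
      using f''_pos[of p] g_supp[of p] by (cases "p \<in> {a..b}") simp_all
  qed
  also have "\<dots> = mean (\<lambda>p. h (x\<^sub>0 + c * f' p))" by (simp add: mean_def)
  finally show ?thesis .
qed

lemma moments_classical_profile:
  assumes u: "\<And>x. (cmod (u x))\<^sup>2 = classical_profile x\<^sub>0 c x" and c: "c \<noteq> 0"
  shows "moment1 u = x\<^sub>0 + c * velocity" and "Var u = c\<^sup>2 * dispersion"
proof -
  have m1: "moment1 u = mean (\<lambda>p. x\<^sub>0 + c * f' p)"
    unfolding moment1_def u by (rule integral_classical_profile[OF continuous_on_id c])
  have "moment2 u = mean (\<lambda>p. (x\<^sub>0 + c * f' p)\<^sup>2)"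
    unfolding moment2_def u by (rule integral_classical_profile[OF _ c]) (intro continuous_intros)
  then show "Var u = c\<^sup>2 * dispersion"
    by (simp only: Var_def m1 variance_affine_velocity)
  show "moment1 u = x\<^sub>0 + c * velocity"
    unfolding m1 by (rule mean_affine_velocity)
qed

end

section \<open>Schwartz functions and symbols\<close>

lemma quadratic_decay_of_bounds:
  fixes v :: "real \<Rightarrow> complex"
  assumes "\<And>x. cmod (v x) \<le> C" "\<And>x. cmod (of_real x ^ 2 * v x) \<le> D"
  shows "cmod (v x) \<le> (C + D) / (1 + x\<^sup>2)"
proof -
  have "cmod (v x) * (1 + x\<^sup>2) \<le> C + D"
    using assms[of x] by (simp add: norm_mult norm_power algebra_simps)
  then show ?thesis by (simp add: pos_le_divide_eq add_pos_nonneg)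
qed

lemma schwartz_continuous:
  assumes "schwartz u" shows "continuous_on UNIV u"
proof -
  have "vderivs 0 u differentiable at x" for x
    using assms unfolding schwartz_def by blast
  then have "u differentiable at x" for x by (simp add: vderivs_def)
  then show ?thesis
    by (intro continuous_at_imp_continuous_on ballI differentiable_imp_continuous_within)
qed

lemma schwartz_bound:
  assumes "schwartz u" obtains C where "\<And>x. cmod (of_real x ^ j * u x) \<le> C"
proof -
  have "\<exists>C. \<forall>x. cmod (of_real x ^ j * vderivs 0 u x) \<le> C"
    using assms unfolding schwartz_def by blast
  then show ?thesis using that by (auto simp: vderivs_def)
qed

text \<open>The bounds on \<open>x\<^sup>j u\<close> of order \<open>j\<close> and \<open>j + 2\<close> together give
  quadratic decay of \<open>x\<^sup>j u\<close>, here for \<open>j\<close> equal to 0 and 1.\<close>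

lemma schwartz_integrable:
  assumes u: "schwartz u"
  shows "integrable lborel u" "integrable lborel (\<lambda>x. of_real x * u x)"
proof -
  obtain C0 where 0: "\<And>x. cmod (of_real x ^ 0 * u x) \<le> C0" by (rule schwartz_bound[OF u]) blast
  obtain C1 where 1: "\<And>x. cmod (of_real x ^ 1 * u x) \<le> C1" by (rule schwartz_bound[OF u]) blast
  obtain C2 where 2: "\<And>x. cmod (of_real x ^ 2 * u x) \<le> C2" by (rule schwartz_bound[OF u]) blast
  obtain C3 where 3: "\<And>x. cmod (of_real x ^ 3 * u x) \<le> C3" by (rule schwartz_bound[OF u]) blast
  have cont: "continuous_on UNIV u" by (rule schwartz_continuous[OF u])
  show "integrable lborel u"
    by (rule integrable_of_quadratic_decay[OF _ quadratic_decay_of_bounds])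
       (use 0 2 in \<open>auto intro!: borel_measurable_continuous_onI cont\<close>)
  show "integrable lborel (\<lambda>x. of_real x * u x)"
    by (rule integrable_of_quadratic_decay[OF _ quadratic_decay_of_bounds])
       (use 1 3 in \<open>auto intro!: borel_measurable_continuous_onI continuous_intros cont
          simp: power3_eq_cube power2_eq_square mult.assoc\<close>)
qed

lemma schwartz_fourier_deriv:
  assumes u: "schwartz u"
  shows "(fourier u has_vector_derivative fourier (\<lambda>x. - \<i> * (of_real x * u x)) p) (at p)"
    and "continuous_on UNIV (fourier (\<lambda>x. - \<i> * (of_real x * u x)))"
  by (intro fourier_has_vector_derivative continuous_fourier integrable_mult_right schwartz_integrable[OF u])+

lemma symbol_derivs:
  assumes "symbol f"
  shows "(f has_real_derivative deriv f p) (at p)"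
    and "(deriv f has_real_derivative deriv (deriv f) p) (at p)"
    and "continuous_on UNIV (deriv (deriv f))"
    and "deriv (deriv f) p > 0"
proof -
  have *: "(deriv ^^ k) f differentiable at x" for k x
    using assms unfolding symbol_def by blast
  have d0: "f differentiable at x" and d1: "deriv f differentiable at x"
    and d2: "deriv (deriv f) differentiable at x" for x
    using *[of 0 x] *[of 1 x] *[of 2 x] by (simp_all add: numeral_2_eq_2)
  show "(f has_real_derivative deriv f p) (at p)"
    and "(deriv f has_real_derivative deriv (deriv f) p) (at p)"
    using d0 d1 by (simp_all add: DERIV_deriv_iff_real_differentiable)
  show "continuous_on UNIV (deriv (deriv f))"
    by (intro continuous_at_imp_continuous_on ballI differentiable_imp_continuous_within d2)
  show "deriv (deriv f) p > 0"
    using assms unfolding symbol_def by blast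
qed

section \<open>Comparison of the two variances\<close>

lemma is_arg_min_parabola:
  fixes \<tau> :: real
  assumes V: "\<And>t. V t = D * (t - \<tau>)\<^sup>2 + c" and D: "D > 0"
  shows "is_arg_min V (\<lambda>_. True) s \<longleftrightarrow> s = \<tau>" and "(LEAST v. v \<in> range V) = c"
proof -
  have V\<tau>: "V \<tau> = c" by (simp add: V)
  have gt: "V t > c" if "t \<noteq> \<tau>" for t using that D by (simp add: V)
  then show "is_arg_min V (\<lambda>_. True) s \<longleftrightarrow> s = \<tau>"
    unfolding is_arg_min_def using V\<tau> by (metis less_asym less_irrefl)
  show "(LEAST v. v \<in> range V) = c"
  proof (rule Least_equality)
    show "c \<in> range V" using V\<tau> by (metis rangeI)
    show "c \<le> v" if "v \<in> range V" for v using that gt V\<tau> by (metis imageE less_imp_le order_refl)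
  qed
qed

theorem corollary4p6:
  fixes p\<^sub>1 p\<^sub>2 tstar xstar :: real
    and f :: "real \<Rightarrow> real"
    and u\<^sub>0 :: "real \<Rightarrow> complex"
  assumes "p\<^sub>1 < p\<^sub>2"
    and "symbol f"
    and "schwartz u\<^sub>0"
    and "closure {p. fourier u\<^sub>0 p \<noteq> 0} \<subseteq> {p\<^sub>1..p\<^sub>2}"
    and "L2_norm u\<^sub>0 = 1"
    and "tstar = arg_min (\<lambda>\<tau>. Var (wave_packet f u\<^sub>0 \<tau>)) (\<lambda>\<tau>. True)"
    and "xstar = moment1 (wave_packet f u\<^sub>0 tstar)"
  shows "(\<exists>!\<tau>. is_arg_min (\<lambda>\<tau>. Var (wave_packet f u\<^sub>0 \<tau>)) (\<lambda>\<tau>. True) \<tau>) \<and>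
    (\<forall>t. t \<noteq> tstar \<longrightarrow>
       moment1 (wave_packet f u\<^sub>0 t) = moment1 (H f u\<^sub>0 tstar xstar t) \<and>
       Var (wave_packet f u\<^sub>0 t) - Var (H f u\<^sub>0 tstar xstar t) =
         (LEAST v. v \<in> range (\<lambda>\<tau>. Var (wave_packet f u\<^sub>0 \<tau>))))"
proof -
  note u = \<open>schwartz u\<^sub>0\<close>
  have mass: "(LINT p|lborel. (cmod (fourier u\<^sub>0 p))\<^sup>2) = 2 * pi"
  proof -
    obtain M where M: "\<And>x. cmod (of_real x ^ 0 * u\<^sub>0 x) \<le> M" by (rule schwartz_bound[OF u]) blast
    have "(LINT x|lborel. (cmod (u\<^sub>0 x))\<^sup>2) = 1"
      using \<open>L2_norm u\<^sub>0 = 1\<close> by (simp add: L2_norm_def)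
    then show ?thesis
      using plancherel(2)[OF schwartz_integrable(1)[OF u] schwartz_continuous[OF u], of M] M by simp
  qed
  have supp: "fourier u\<^sub>0 p = 0" if "p \<notin> {p\<^sub>1..p\<^sub>2}" for p
    using that \<open>closure _ \<subseteq> _\<close> closure_subset[of "{p. fourier u\<^sub>0 p \<noteq> 0}"] by blast
  interpret dispersive_packet p\<^sub>1 p\<^sub>2 "fourier u\<^sub>0" "fourier (\<lambda>x. - \<i> * (of_real x * u\<^sub>0 x))"
    f "deriv f" "deriv (deriv f)"
    by unfold_locales
       (fact \<open>p\<^sub>1 < p\<^sub>2\<close> schwartz_fourier_deriv[OF u] supp mass symbol_derivs[OF \<open>symbol f\<close>])+
  have packet: "wave_packet f u\<^sub>0 t = packet t" for t
  proof
    fix x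
    have "fourier (amplitude t) (- x)
      = (LINT p|lborel. fourier u\<^sub>0 p * exp (- \<i> * of_real (t * f p) + \<i> * of_real (x * p)))"
      unfolding fourier_def[of "amplitude t"] amplitude_def
      by (intro Bochner_Integration.integral_cong) (simp_all add: exp_add[symmetric] mult.assoc mult.commute[of _ x])
    then show "wave_packet f u\<^sub>0 t x = packet t x"
      by (simp add: wave_packet_def packet_def)
  qed
  \<comment> \<open>The phases of \<open>H\<close> have modulus 1, so its density is the classical one.\<close>
  have profile: "(cmod (H f u\<^sub>0 t\<^sub>0 x\<^sub>0 t x))\<^sup>2 = classical_profile x\<^sub>0 (t - t\<^sub>0) x" if "t \<noteq> t\<^sub>0" for t t\<^sub>0 x\<^sub>0 x
  proof -
    have "(\<bar>t - t\<^sub>0\<bar> powr (- 1 / 2))\<^sup>2 = 1 / \<bar>t - t\<^sub>0\<bar>"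
      using that by (simp add: power2_eq_square powr_add[symmetric] powr_minus_divide)
    moreover have "cmod (exp (- of_real s * \<i> * of_real r)) = 1" "cmod (exp (- \<i> * of_real s + \<i> * of_real r)) = 1" for s r
      by (simp_all add: norm_exp_eq_Re)
    ultimately show ?thesis
      using f''_pos
      by (simp only: H_def classical_profile_def Let_def if_distrib[of cmod] if_distrib[of "\<lambda>r. r\<^sup>2"] norm_mult norm_divide norm_of_real power_mult_distrib power_divide)
         (simp add: less_imp_le power_divide mult.assoc)
  qed
  obtain \<tau> c where V: "\<And>t. Var (packet t) = dispersion * (t - \<tau>)\<^sup>2 + c"
    using Var_packet_parabola by blast
  note arg_min = is_arg_min_parabola[of "\<lambda>t. Var (packet t)", OF V dispersion_pos]
  have tstar: "tstar = \<tau>"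
  proof -
    have "is_arg_min (\<lambda>t. Var (packet t)) (\<lambda>_. True) \<tau>" using arg_min(1) by simp
    then have "is_arg_min (\<lambda>t. Var (packet t)) (\<lambda>_. True) tstar"
      unfolding \<open>tstar = _\<close> packet arg_min_def by (rule someI)
    then show ?thesis using arg_min(1) by simp
  qed
  have xstar: "xstar = center + tstar * velocity"
    using \<open>xstar = _\<close> by (simp add: packet moment1_packet)
  show ?thesis
    unfolding packet arg_min
  proof (intro conjI allI impI)
    fix t assume "t \<noteq> tstar"
    then have H: "moment1 (H f u\<^sub>0 tstar xstar t) = xstar + (t - tstar) * velocity"
      "Var (H f u\<^sub>0 tstar xstar t) = (t - tstar)\<^sup>2 * dispersion"
      using moments_classical_profile[OF profile] by simp_all
    show "moment1 (packet t) = moment1 (H f u\<^sub>0 tstar xstar t)"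
      by (simp only: H) (simp add: xstar moment1_packet algebra_simps)
    show "Var (packet t) - Var (H f u\<^sub>0 tstar xstar t) = c"
      by (simp only: H V) (simp add: tstar)
  qed simp
qed

end
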